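(* Let $([n],\mathcal{B})$ be a $2$-$(n,b,r,k,\lambda)$ quasi-symmetric design with intersection numbers $x$ and $y$. If $x+y\le 2kr/b$, then there exist $b$ equiangular lines in $\mathbb{R}^n$.
   Context: $[n]=\{1,\dots,n\}$. A $2$-$(n,b,r,k,\lambda)$ design on $[n]$ ($2\le k<n$) is a collection $\mathcal{B}$ of $b$ $k$-element subsets (blocks) of $[n]$ such that every $2$-subset of $[n]$ is contained in exactly $\lambda\ge1$ blocks; every point then lies in exactly $r$ blocks. It is quasi-symmetric with intersection numbers $x\neq y$ if any two (different) blocks intersect in either $x$ or $y$ points, with both values occurring. A set of lines through the origin in $\mathbb{R}^n$ is equiangular if the angle between each pair of distinct lines is the same; equivalently, for unit vectors $y_i$ spanning the lines there is $a\in[0,1)$ with $|\langle y_i,y_j\rangle|=a$ for all $i\neq j$. *)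

theory Defs
  imports "HOL-Analysis.Analysis"
begin

text \<open>A 2-design on the point set \<open>{1..n}\<close>. Blocks form a set, so there are no repeated blocks.
  The last conjunct, which follows from the others for a suitable \<open>r\<close>, fixes the parameter \<open>r\<close>.\<close>

definition two_design :: "nat \<Rightarrow> nat \<Rightarrow> nat \<Rightarrow> nat \<Rightarrow> nat \<Rightarrow> nat set set \<Rightarrow> bool" where
  "two_design n b r k l \<B> \<longleftrightarrow>
     2 \<le> k \<and> k < n \<and> 1 \<le> l \<and>
     (\<forall>B\<in>\<B>. B \<subseteq> {1..n} \<and> card B = k) \<and>
     card \<B> = b \<and>
     (\<forall>p\<in>{1..n}. \<forall>q\<in>{1..n}. p \<noteq> q \<longrightarrow> card {B\<in>\<B>. {p, q} \<subseteq> B} = l) \<and>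
     (\<forall>p\<in>{1..n}. card {B\<in>\<B>. p \<in> B} = r)"

definition quasi_symmetric_design ::
  "nat \<Rightarrow> nat \<Rightarrow> nat \<Rightarrow> nat \<Rightarrow> nat \<Rightarrow> nat \<Rightarrow> nat \<Rightarrow> nat set set \<Rightarrow> bool" where
  "quasi_symmetric_design n b r k l x y \<B> \<longleftrightarrow>
     two_design n b r k l \<B> \<and> x \<noteq> y \<and>
     (\<forall>B\<in>\<B>. \<forall>C\<in>\<B>. B \<noteq> C \<longrightarrow> card (B \<inter> C) = x \<or> card (B \<inter> C) = y) \<and>
     (\<exists>B\<in>\<B>. \<exists>C\<in>\<B>. B \<noteq> C \<and> card (B \<inter> C) = x) \<and>
     (\<exists>B\<in>\<B>. \<exists>C\<in>\<B>. B \<noteq> C \<and> card (B \<inter> C) = y)"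

definition line_through_origin :: "'a::euclidean_space set \<Rightarrow> bool" where
  "line_through_origin m \<longleftrightarrow> subspace m \<and> dim m = 1"

text \<open>The (non-obtuse) angle between the lines spanned by two nonzero vectors \<open>u\<close> and \<open>v\<close>;
  the absolute value makes it independent of the choice of the spanning vectors.\<close>

definition line_angle :: "'a::euclidean_space \<Rightarrow> 'a \<Rightarrow> real" where
  "line_angle u v = arccos (\<bar>u \<bullet> v\<bar> / (norm u * norm v))"

definition equiangular_lines :: "'a::euclidean_space set set \<Rightarrow> bool" where
  "equiangular_lines L \<longleftrightarrow>
     (\<forall>m\<in>L. line_through_origin m) \<and>
     (\<exists>\<theta>. \<forall>m\<in>L. \<forall>m'\<in>L. m \<noteq> m' \<longrightarrow>
        (\<forall>u\<in>m - {0}. \<forall>v\<in>m' - {0}. line_angle u v = \<theta>))"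

end

theory Submission imports Defs begin

text \<open>Shifting the characteristic vector of every block by the same multiple \<open>c\<close> of the all-ones
  vector adds \<open>2kc + nc\<^sup>2\<close> to all inner products. Double counting gives \<open>bk = nr\<close>, so the hypothesis
  says \<open>x + y \<le> 2k\<^sup>2/n\<close>, which is exactly the condition for a real \<open>c\<close> with
  \<open>2kc + nc\<^sup>2 = -(x + y)/2\<close> to exist. Distinct shifted vectors then have inner product \<open>\<plusminus>(x - y)/2\<close>
  and squared norm \<open>k - (x + y)/2\<close>, which is larger than \<open>\<bar>x - y\<bar>/2\<close> because \<open>x, y < k\<close>.\<close>

lemma line_through_origin_span:
  fixes u :: "'a::euclidean_space"
  assumes "u \<noteq> 0"
  shows "line_through_origin (span {u})"
  using assms by (simp add: line_through_origin_def dim_insert)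

lemma line_angle_scaleR:
  assumes "\<alpha> \<noteq> 0" "\<beta> \<noteq> 0"
  shows "line_angle (\<alpha> *\<^sub>R u) (\<beta> *\<^sub>R v) = line_angle u v"
  using assms by (simp add: line_angle_def abs_mult)

text \<open>Strictness in \<open>a < s\<close> keeps the lines distinct: two vectors of squared norm
  \<open>s\<close> on one line attain equality in Cauchy-Schwarz, so their inner product is
  \<open>s\<close> in absolute value.\<close>

lemma equiangular_lines_span_image:
  fixes v :: "'i \<Rightarrow> 'a::euclidean_space"
  assumes norm: "\<And>i. i \<in> I \<Longrightarrow> v i \<bullet> v i = s"
    and inner: "\<And>i j. i \<in> I \<Longrightarrow> j \<in> I \<Longrightarrow> i \<noteq> j \<Longrightarrow> \<bar>v i \<bullet> v j\<bar> = a"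
    and "a < s" "0 < s"
  shows "inj_on (\<lambda>i. span {v i}) I" "equiangular_lines ((\<lambda>i. span {v i}) ` I)"
proof -
  have norm_eq: "norm (v i) = sqrt s" if "i \<in> I" for i
    using norm[OF that] by (simp add: norm_eq_sqrt_inner)
  have nonzero: "v i \<noteq> 0" if "i \<in> I" for i
    using norm[OF that] \<open>0 < s\<close> by auto
  show "inj_on (\<lambda>i. span {v i}) I"
  proof (rule inj_onI, rule ccontr)
    fix i j assume ij: "i \<in> I" "j \<in> I" "span {v i} = span {v j}" "i \<noteq> j"
    then have "v i \<in> span {v j}"
      by (metis insertI1 span_base)
    then have "\<bar>v i \<bullet> v j\<bar> = norm (v i) * norm (v j)"
      by (auto simp: span_singleton abs_mult power2_norm_eq_inner[symmetric] power2_eq_square)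
    then show False
      using ij inner[OF ij(1,2,4)] norm_eq \<open>a < s\<close> \<open>0 < s\<close> by simp
  qed
  have "line_angle p q = arccos (a / s)"
    if ij: "i \<in> I" "j \<in> I" "i \<noteq> j"
      and pq: "p \<in> span {v i} - {0}" "q \<in> span {v j} - {0}" for i j p q
  proof -
    \<comment> \<open>Nonzero vectors of the two lines are arbitrary here; rescaling reduces them to
      the spanning vectors.\<close>
    obtain \<alpha> \<beta> where "p = \<alpha> *\<^sub>R v i" "q = \<beta> *\<^sub>R v j" "\<alpha> \<noteq> 0" "\<beta> \<noteq> 0"
      using pq by (auto simp: span_singleton)
    then have "line_angle p q = line_angle (v i) (v j)"
      by (simp add: line_angle_scaleR)
    also have "\<dots> = arccos (a / s)"
      using ij inner[OF ij] norm_eq \<open>0 < s\<close> by (simp add: line_angle_def)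
    finally show ?thesis .
  qed
  then show "equiangular_lines ((\<lambda>i. span {v i}) ` I)"
    unfolding equiangular_lines_def
    using nonzero by (intro conjI exI[of _ "arccos (a / s)"]) (auto intro!: line_through_origin_span)
qed

lemma two_design_finite:
  assumes "two_design n b r k l \<B>"
  shows "finite \<B>"
  using assms by (intro finite_subset[of \<B> "Pow {1..n}"]) (auto simp: two_design_def)

text \<open>Both sides count the incident pairs of a point and a block, by blocks and by
  points.\<close>

lemma two_design_incidences:
  assumes "two_design n b r k l \<B>"
  shows "b * k = n * r"
proof -
  have "(\<Sum>B\<in>\<B>. card {p\<in>{1..n}. p \<in> B}) = (\<Sum>p\<in>{1..n}. r)"
    using assms two_design_finite[OF assms]
    by (intro sum_multicount_gen) (auto simp: two_design_def)
  moreover have "{p\<in>{1..n}. p \<in> B} = B" if "B \<in> \<B>" for B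
    using assms that unfolding two_design_def by blast
  then have "(\<Sum>B\<in>\<B>. card {p\<in>{1..n}. p \<in> B}) = (\<Sum>B\<in>\<B>. k)"
    using assms by (intro sum.cong) (auto simp: two_design_def)
  ultimately show ?thesis
    using assms by (simp add: two_design_def)
qed

text \<open>Finite sets of equal size cannot be properly nested.\<close>

lemma two_design_card_Int_less:
  assumes "two_design n b r k l \<B>" "B \<in> \<B>" "C \<in> \<B>" "B \<noteq> C"
  shows "card (B \<inter> C) < k"
proof -
  have BC: "finite B" "finite C" "card B = k" "card C = k"
    using assms by (auto simp: two_design_def intro: finite_subset)
  then have "B \<inter> C \<noteq> B"
    using assms(4) card_subset_eq[of C B] by auto
  then have "B \<inter> C \<subset> B"
    by blast
  then show ?thesis
    using BC psubset_card_mono by blast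
qed

text \<open>Coordinates are indexed by a finite type, while blocks are sets of points;
  \<open>f\<close> sends each coordinate to its point.\<close>

definition shifted_indicator :: "('n::finite \<Rightarrow> 'a) \<Rightarrow> real \<Rightarrow> 'a set \<Rightarrow> real ^ 'n" where
  "shifted_indicator f c B = (\<chi> i. indicat_real B (f i) + c)"

text \<open>Expanding the product coordinatewise, the shift contributes terms that depend only on
  the sizes of the sets, hence the same amount for all pairs of blocks.\<close>

lemma shifted_indicator_inner:
  fixes f :: "'n::finite \<Rightarrow> 'a" and c :: real
  assumes f: "bij_betw f UNIV P" and "B \<subseteq> P" "C \<subseteq> P"
  shows "shifted_indicator f c B \<bullet> shifted_indicator f c C
    = real (card (B \<inter> C)) + c * (real (card B) + real (card C)) + c\<^sup>2 * real (card P)"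
proof -
  have "finite P"
    using bij_betw_finite[OF f] by simp
  then have sum_indicat: "(\<Sum>p\<in>P. indicat_real A p) = card A" if "A \<subseteq> P" for A
    using that by (simp add: indicator_def sum.If_cases Int_absorb1)
  have "shifted_indicator f c B \<bullet> shifted_indicator f c C
      = (\<Sum>i\<in>UNIV. (indicat_real B (f i) + c) * (indicat_real C (f i) + c))"
    by (simp add: shifted_indicator_def inner_vec_def)
  also have "\<dots> = (\<Sum>p\<in>P. (indicat_real B p + c) * (indicat_real C p + c))"
    by (rule sum.reindex_bij_betw[OF f])
  also have "\<dots> = (\<Sum>p\<in>P. indicat_real (B \<inter> C) p + c * (indicat_real B p + indicat_real C p) + c\<^sup>2)"
    by (intro sum.cong refl) (simp add: indicator_inter_arith algebra_simps power2_eq_square)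
  also have "\<dots> = real (card (B \<inter> C)) + c * (real (card B) + real (card C)) + c\<^sup>2 * real (card P)"
    using assms(2,3) by (simp add: sum.distrib sum_distrib_left[symmetric] sum_indicat le_infI1 mult.commute)
  finally show ?thesis .
qed

theorem corollary4p4:
  fixes n b r k l x y :: nat and \<B> :: "nat set set"
  assumes "CARD('n::finite) = n"
    and "quasi_symmetric_design n b r k l x y \<B>"
    and "real x + real y \<le> 2 * real k * real r / real b"
  shows "\<exists>L :: (real ^ 'n) set set. finite L \<and> card L = b \<and> equiangular_lines L"
proof -
  have design: "two_design n b r k l \<B>"
    and meet: "\<And>B C. B \<in> \<B> \<Longrightarrow> C \<in> \<B> \<Longrightarrow> B \<noteq> C \<Longrightarrow> card (B \<inter> C) = x \<or> card (B \<inter> C) = y"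
    and ex_x: "\<exists>B\<in>\<B>. \<exists>C\<in>\<B>. B \<noteq> C \<and> card (B \<inter> C) = x"
    and ex_y: "\<exists>B\<in>\<B>. \<exists>C\<in>\<B>. B \<noteq> C \<and> card (B \<inter> C) = y"
    using assms(2) by (auto simp: quasi_symmetric_design_def)
  have fin: "finite \<B>" and "card \<B> = b" "k < n"
    and blocks: "\<And>B. B \<in> \<B> \<Longrightarrow> B \<subseteq> {1..n} \<and> card B = k"
    using two_design_finite[OF design] design by (auto simp: two_design_def)
  have "x < k" "y < k"
    using ex_x ex_y two_design_card_Int_less[OF design] by auto
  \<comment> \<open>This excludes the default value of division by zero in
    \<open>r / b\<close>.\<close>
  have "0 < b"
    using ex_x fin \<open>card \<B> = b\<close> by (auto simp: card_gt_0_iff)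
  moreover have "real b * real k = real n * real r"
    using two_design_incidences[OF design] by (metis of_nat_mult)
  ultimately have "real r / real b = real k / real n"
    using \<open>k < n\<close> by (simp add: frac_eq_eq mult.commute)
  then have "real x + real y \<le> 2 * real k * (real k / real n)"
    using assms(3) by (metis times_divide_eq_right)
  \<comment> \<open>A quarter of the discriminant of
    \<open>n * c\<^sup>2 + 2 * k * c + (x + y) / 2\<close> as a quadratic in
    \<open>c\<close>.\<close>
  then have disc: "0 \<le> (real k)\<^sup>2 - n * (real x + real y) / 2"
    using \<open>k < n\<close> by (simp add: field_simps power2_eq_square)
  define d where "d = sqrt ((real k)\<^sup>2 - n * (real x + real y) / 2)"
  \<comment> \<open>The root of that quadratic with the positive sign before the square
    root.\<close>
  define c where "c = (d - k) / n"
  have "d\<^sup>2 = (real k)\<^sup>2 - n * (real x + real y) / 2"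
    using disc by (simp add: d_def)
  moreover have d_eq: "d = n * c + k"
    using \<open>k < n\<close> by (simp add: c_def)
  \<comment> \<open>Comparing the two expressions for \<open>d\<^sup>2\<close> undoes the completed
    square; the factor \<open>n\<close> is cancelled next.\<close>
  ultimately have "real n * (2 * real k * c + real n * c\<^sup>2) = real n * (- (real x + real y) / 2)"
    by (simp add: power2_eq_square field_simps)
  then have c: "2 * real k * c + real n * c\<^sup>2 = - (real x + real y) / 2"
    using \<open>k < n\<close> by (metis mult_cancel_left of_nat_eq_0_iff not_less_zero)
  obtain f :: "'n \<Rightarrow> nat" where f: "bij_betw f UNIV {1..n}"
    using finite_same_card_bij[of "UNIV :: 'n set" "{1..n}"] assms(1) by auto
  let ?v = "shifted_indicator f c"
  have inner: "?v B \<bullet> ?v C = card (B \<inter> C) - (real x + real y) / 2" if "B \<in> \<B>" "C \<in> \<B>" for B C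
    using shifted_indicator_inner[OF f, of B C c] blocks[OF that(1)] blocks[OF that(2)] c
    by (simp add: field_simps)
  have norm: "?v B \<bullet> ?v B = k - (real x + real y) / 2" if "B \<in> \<B>" for B
    using inner[OF that that] blocks[OF that] by simp
  have abs_inner: "\<bar>?v B \<bullet> ?v C\<bar> = \<bar>real x - real y\<bar> / 2" if "B \<in> \<B>" "C \<in> \<B>" "B \<noteq> C" for B C
    using inner[OF that(1,2)] meet[OF that] by (auto simp: field_simps abs_if)
  \<comment> \<open>Adding \<open>(x + y) / 2\<close> to \<open>\<bar>x - y\<bar> / 2\<close> gives
    the larger of \<open>x\<close> and \<open>y\<close>.\<close>
  have less: "\<bar>real x - real y\<bar> / 2 < k - (real x + real y) / 2" "0 < k - (real x + real y) / 2"
    using \<open>x < k\<close> \<open>y < k\<close> by (auto simp: abs_if field_simps)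
  \<comment> \<open>Injectivity yields exactly one line per block, hence \<open>b\<close>
    lines.\<close>
  have "inj_on (\<lambda>B. span {?v B}) \<B>"
    by (rule equiangular_lines_span_image(1)[OF norm abs_inner less])
  moreover have "equiangular_lines ((\<lambda>B. span {?v B}) ` \<B>)"
    by (rule equiangular_lines_span_image(2)[OF norm abs_inner less])
  ultimately show ?thesis
    using fin \<open>card \<B> = b\<close> by (intro exI[of _ "(\<lambda>B. span {?v B}) ` \<B>"]) (simp add: card_image)
qed

end
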